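(* Let $\mathcal{C}\subseteq\mathbb{N}^p$ be an affine integer cone and let $\preceq$ be a total order on $\mathbb{N}^p$ such that $\mathcal{N}(x)$ is finite for every $x\in\mathcal{C}$. If $g$ is a positive integer and $\mathcal{F}(g)=\{\mathrm{Fb}(S)\mid S\text{ is a }\mathcal{C}\text{-semigroup of genus }g\}$, then $$\mathcal{F}(g)=\left\{f\in\mathcal{C}\ \Big|\ \left\lceil\frac{\sharp\mathcal{B}(f)}{2}\right\rceil\leq g\leq\mathcal{N}(f)\right\}.$$
   Context: $\mathbb{N}$ contains $0$. An affine integer cone $\mathcal{C}\subseteq\mathbb{N}^p$ is a set $L(A)\cap\mathbb{N}^p$ with $A\subseteq\mathcal{C}$ finite and non-empty, where $L(A)$ is the set of non-negative real linear combinations of elements of $A$. A $\mathcal{C}$-semigroup is a submonoid $S\subseteq\mathcal{C}$ (containing $0$) with $\mathcal{C}\setminus S$ finite; its genus is $\sharp(\mathcal{C}\setminus S)$, where $\sharp$ denotes cardinality. A total order on $\mathbb{N}^p$ means a total order relation compatible with addition and satisfying $0\preceq x$ for all $x$. For $S\neq\mathcal{C}$, $\mathrm{Fb}(S)=\max_\preceq(\mathcal{C}\setminus S)$. For $f\in\mathcal{C}$, $\mathcal{N}(f)=\sharp\{x\in\mathcal{C}\setminus\{0\}\mid x\preceq f\}$ and $\mathcal{B}(f)=\{x\in\mathcal{C}\mid f-x\in\mathcal{C}\}$. *)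

theory Defs
  imports "HOL-Analysis.Analysis"
begin

definition real_vec :: "nat ^ 'p \<Rightarrow> real ^ 'p" where
  "real_vec x = (\<chi> i. real (x $ i))"

definition nonneg_combinations :: "(nat ^ 'p) set \<Rightarrow> (real ^ 'p) set" where
  "nonneg_combinations A =
     {\<Sum>a\<in>F. c a *\<^sub>R real_vec a | F c. finite F \<and> F \<subseteq> A \<and> (\<forall>a\<in>F. 0 \<le> c a)}"

definition affine_integer_cone :: "(nat ^ 'p) set \<Rightarrow> bool" where
  "affine_integer_cone C \<longleftrightarrow>
     (\<exists>A. finite A \<and> A \<noteq> {} \<and> A \<subseteq> C \<and> C = {x. real_vec x \<in> nonneg_combinations A})"

definition c_semigroup :: "(nat ^ 'p) set \<Rightarrow> (nat ^ 'p) set \<Rightarrow> bool" where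
  "c_semigroup C S \<longleftrightarrow>
     S \<subseteq> C \<and> 0 \<in> S \<and> (\<forall>x\<in>S. \<forall>y\<in>S. x + y \<in> S) \<and> finite (C - S)"

definition genus :: "(nat ^ 'p) set \<Rightarrow> (nat ^ 'p) set \<Rightarrow> nat" where
  "genus C S = card (C - S)"

text \<open>The pair \<open>(x, y) \<in> r\<close> stands for \<open>x \<preceq> y\<close>; the relation \<open>\<le>\<close> on \<open>nat ^ 'p\<close> is the
  componentwise partial order and is unrelated to \<open>r\<close>.\<close>

definition compatible_total_order :: "(nat ^ 'p) rel \<Rightarrow> bool" where
  "compatible_total_order r \<longleftrightarrow>
     linear_order r \<and> (\<forall>x y z. (x, y) \<in> r \<longrightarrow> (x + z, y + z) \<in> r) \<and> (\<forall>x. (0, x) \<in> r)"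

text \<open>The maximum of \<open>C - S\<close> with respect to \<open>r\<close>; meaningful only if \<open>C - S\<close> is finite and
  nonempty.\<close>

definition Fb :: "(nat ^ 'p) rel \<Rightarrow> (nat ^ 'p) set \<Rightarrow> (nat ^ 'p) set \<Rightarrow> nat ^ 'p" where
  "Fb r C S = (THE f. f \<in> C - S \<and> (\<forall>x\<in>C - S. (x, f) \<in> r))"

definition nonzero_below :: "(nat ^ 'p) rel \<Rightarrow> (nat ^ 'p) set \<Rightarrow> nat ^ 'p \<Rightarrow> (nat ^ 'p) set" where
  "nonzero_below r C f = {x \<in> C - {0}. (x, f) \<in> r}"

definition N_count :: "(nat ^ 'p) rel \<Rightarrow> (nat ^ 'p) set \<Rightarrow> nat ^ 'p \<Rightarrow> nat" where
  "N_count r C f = card (nonzero_below r C f)"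

text \<open>Subtraction on \<open>nat ^ 'p\<close> truncates componentwise, so \<open>x \<le> f\<close> expresses that the
  difference \<open>f - x\<close>, taken over the integers, lies in \<open>\<nat>\<^sup>p\<close> at all.\<close>

definition B_set :: "(nat ^ 'p) set \<Rightarrow> nat ^ 'p \<Rightarrow> (nat ^ 'p) set" where
  "B_set C f = {x \<in> C. x \<le> f \<and> f - x \<in> C}"

definition frobenius_elements :: "(nat ^ 'p) rel \<Rightarrow> (nat ^ 'p) set \<Rightarrow> nat \<Rightarrow> (nat ^ 'p) set" where
  "frobenius_elements r C g = {Fb r C S | S. c_semigroup C S \<and> genus C S = g}"

end

theory Submission
  imports Defs
begin

text \<open>The involution \<open>x \<mapsto> f - x\<close> of \<open>B(f)\<close> sends elements of \<open>S\<close> to gaps, whence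
  \<open>\<sharp>B(f) \<le> 2g\<close>. Conversely, since \<open>C - B(f)\<close> is an ideal of \<open>C\<close>, the elements of \<open>C - {f}\<close> that
  are \<open>0\<close>, lie outside \<open>B(f)\<close>, or have double above \<open>f\<close> form a \<open>C\<close>-semigroup with Frobenius
  element \<open>f\<close>, whose gaps contain one element of each pair \<open>{x, f - x}\<close> in \<open>B(f)\<close>. Removing
  successively the smallest nonzero element raises the genus by one each time, until every
  nonzero element of \<open>C\<close> up to \<open>f\<close> is a gap.\<close>

section \<open>The cone as a submonoid\<close>

lemma zero_in_cone:
  assumes "affine_integer_cone C"
  shows "0 \<in> C"
proof -
  obtain A where C: "C = {x. real_vec x \<in> nonneg_combinations A}"
    using assms unfolding affine_integer_cone_def by blast
  have "real_vec 0 = (\<Sum>a\<in>{}. 0 *\<^sub>R real_vec a)"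
    by (simp add: real_vec_def vec_eq_iff)
  then show ?thesis
    unfolding C nonneg_combinations_def by (intro CollectI exI[of _ "{}"]) auto
qed

lemma nonneg_combinations_add:
  assumes "u \<in> nonneg_combinations A" "v \<in> nonneg_combinations A"
  shows "u + v \<in> nonneg_combinations A"
proof -
  obtain F c where F: "u = (\<Sum>a\<in>F. c a *\<^sub>R real_vec a)" "finite F" "F \<subseteq> A" "\<forall>a\<in>F. 0 \<le> c a"
    using assms(1) unfolding nonneg_combinations_def by blast
  obtain G d where G: "v = (\<Sum>a\<in>G. d a *\<^sub>R real_vec a)" "finite G" "G \<subseteq> A" "\<forall>a\<in>G. 0 \<le> d a"
    using assms(2) unfolding nonneg_combinations_def by blast
  \<comment> \<open>The two finite supports may differ, so each coefficient family is extended by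
    zero to \<open>F \<union> G\<close> before adding.\<close>
  define e where "e a = (if a \<in> F then c a else 0) + (if a \<in> G then d a else 0)" for a
  have "(\<Sum>a\<in>F \<union> G. (if a \<in> F then c a else 0) *\<^sub>R real_vec a) = u"
    unfolding F(1) by (rule sum.mono_neutral_cong_right) (use F G in auto)
  moreover have "(\<Sum>a\<in>F \<union> G. (if a \<in> G then d a else 0) *\<^sub>R real_vec a) = v"
    unfolding G(1) by (rule sum.mono_neutral_cong_right) (use F G in auto)
  ultimately have "u + v = (\<Sum>a\<in>F \<union> G. e a *\<^sub>R real_vec a)"
    by (simp add: e_def scaleR_left_distrib sum.distrib)
  moreover have "\<forall>a\<in>F \<union> G. 0 \<le> e a"
    using F(4) G(4) by (auto simp: e_def)
  ultimately show ?thesis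
    using F(2,3) G(2,3) unfolding nonneg_combinations_def
    by (intro CollectI exI[of _ "F \<union> G"] exI[of _ e]) auto
qed

lemma cone_add:
  assumes "affine_integer_cone C" "x \<in> C" "y \<in> C"
  shows "x + y \<in> C"
proof -
  obtain A where C: "C = {x. real_vec x \<in> nonneg_combinations A}"
    using assms(1) unfolding affine_integer_cone_def by blast
  have "real_vec (x + y) = real_vec x + real_vec y"
    by (simp add: real_vec_def vec_eq_iff)
  then show ?thesis
    using assms(2,3) nonneg_combinations_add unfolding C by auto
qed

section \<open>The reflection of \<open>B_set C f\<close>\<close>

lemma vec_le_add_diff:
  fixes x y :: "nat ^ 'p"
  assumes "x \<le> y"
  shows "x + (y - x) = y"
  using assms by (simp add: less_eq_vec_def vec_eq_iff)

text \<open>Trades truncated subtraction for an additive witness, the form in which the monoid laws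
  apply.\<close>

lemma B_set_iff: "x \<in> B_set C f \<longleftrightarrow> x \<in> C \<and> (\<exists>y\<in>C. x + y = f)"
proof -
  have "x \<le> x + y \<and> (x + y) - x = y" for x y :: "nat ^ 'a"
    by (simp add: less_eq_vec_def vec_eq_iff)
  then show ?thesis
    unfolding B_set_def by (auto intro: vec_le_add_diff)
qed

lemma B_set_diff:
  assumes "x \<in> B_set C f"
  shows "f - x \<in> B_set C f" "x + (f - x) = f"
proof -
  show sum: "x + (f - x) = f"
    using assms unfolding B_set_def by (simp add: vec_le_add_diff)
  show "f - x \<in> B_set C f"
    using assms sum unfolding B_set_iff by (auto simp: B_set_def add.commute)
qed

text \<open>Truncated subtraction from \<open>f\<close> is not injective in general; on
  \<open>B_set C f\<close> the identity \<open>x + (f - x) = f\<close> recovers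
  \<open>x\<close>.\<close>

lemma inj_on_diff_B_set: "inj_on (\<lambda>x. f - x) (B_set C f)"
proof (rule inj_onI)
  fix x y
  assume "x \<in> B_set C f" "y \<in> B_set C f" and eq: "f - x = f - y"
  then have "x + (f - x) = y + (f - x)"
    by (metis B_set_diff(2))
  then show "x = y"
    by simp
qed

section \<open>Cones with a compatible total order\<close>

locale ordered_cone =
  fixes C :: "(nat ^ 'p) set" and r :: "(nat ^ 'p) rel"
  assumes cone: "affine_integer_cone C"
    and order: "compatible_total_order r"
    and finite_below: "x \<in> C \<Longrightarrow> finite (nonzero_below r C x)"
begin

abbreviation le (infix "\<preceq>" 50) where "x \<preceq> y \<equiv> (x, y) \<in> r"

lemma
  shows le_refl: "x \<preceq> x"
    and le_trans: "x \<preceq> y \<Longrightarrow> y \<preceq> z \<Longrightarrow> x \<preceq> z"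
    and le_antisym: "x \<preceq> y \<Longrightarrow> y \<preceq> x \<Longrightarrow> x = y"
    and le_total: "x \<preceq> y \<or> y \<preceq> x"
    and le_add_mono: "x \<preceq> y \<Longrightarrow> x + z \<preceq> y + z"
    and zero_le: "0 \<preceq> x"
  using order
  unfolding compatible_total_order_def linear_order_on_def partial_order_on_def preorder_on_def
  by (auto simp: refl_on_def dest: transD antisymD) (metis UNIV_I total_on_def)

lemma le_add: "x \<preceq> x + y"
  using le_add_mono[OF zero_le[of y], of x] by (simp add: add.commute)

text \<open>By totality the alternative is \<open>y \<preceq> x\<close>; adding \<open>z\<close> and
  antisymmetry then force \<open>x = y\<close>.\<close>

lemma add_le_cancel: "x + z \<preceq> y + z \<Longrightarrow> x \<preceq> y"
  by (metis add_right_cancel le_add_mono le_antisym le_refl le_total)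

lemma double_le_add: "x + x \<preceq> x + y \<longleftrightarrow> x \<preceq> y"
  by (metis add.commute add_le_cancel le_add_mono)

text \<open>The smaller of the two summands has its double below \<open>x + y\<close>.\<close>

lemma add_le_imp:
  assumes "x + y \<preceq> f"
  shows "x + x \<preceq> f \<or> y + y \<preceq> f"
  by (metis add.commute assms double_le_add le_total le_trans)

lemma B_set_le:
  assumes "x \<in> B_set C f"
  shows "x \<preceq> f"
  by (metis B_set_diff(2) assms le_add)

lemma finite_B_set:
  assumes "f \<in> C"
  shows "finite (B_set C f)"
proof (rule finite_subset)
  show "B_set C f \<subseteq> insert 0 (nonzero_below r C f)"
    using B_set_le by (auto simp: nonzero_below_def B_set_def)
qed (simp add: assms finite_below)

lemma finite_has_least:
  assumes "finite X" "X \<noteq> {}"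
  shows "\<exists>m\<in>X. \<forall>x\<in>X. m \<preceq> x"
  using assms
proof (induction rule: finite_ne_induct)
  case (singleton x)
  then show ?case by (simp add: le_refl)
next
  case (insert x F)
  then show ?case by (metis insert_iff le_refl le_total le_trans)
qed

lemma finite_has_greatest:
  assumes "finite X" "X \<noteq> {}"
  shows "\<exists>m\<in>X. \<forall>x\<in>X. x \<preceq> m"
  using assms
proof (induction rule: finite_ne_induct)
  case (singleton x)
  then show ?case by (simp add: le_refl)
next
  case (insert x F)
  then show ?case by (metis insert_iff le_refl le_total le_trans)
qed

text \<open>Relational form of \<open>Fb\<close>: it asserts that the maximum exists, so no argument
  has to go through the definite description.\<close>

definition has_Fb :: "(nat ^ 'p) set \<Rightarrow> nat ^ 'p \<Rightarrow> bool" where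
  "has_Fb S f \<longleftrightarrow> f \<in> C - S \<and> (\<forall>x\<in>C - S. x \<preceq> f)"

lemma Fb_eqI: "has_Fb S f \<Longrightarrow> Fb r C S = f"
  unfolding Fb_def has_Fb_def by (rule the_equality) (auto intro: le_antisym)

lemma has_Fb_Fb:
  assumes "c_semigroup C S" "genus C S > 0"
  shows "has_Fb S (Fb r C S)"
proof -
  have "finite (C - S)" "C - S \<noteq> {}"
    using assms unfolding genus_def by (auto simp: card_gt_0_iff)
  then obtain f where "has_Fb S f"
    using finite_has_greatest unfolding has_Fb_def by meson
  then show ?thesis
    using Fb_eqI by metis
qed

section \<open>Bounds on the genus\<close>

lemma gaps_subset_nonzero_below:
  assumes "c_semigroup C S" "has_Fb S f"
  shows "C - S \<subseteq> nonzero_below r C f"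
  using assms unfolding c_semigroup_def has_Fb_def nonzero_below_def by auto

lemma genus_le_N_count:
  assumes "c_semigroup C S" "has_Fb S f"
  shows "genus C S \<le> N_count r C f"
  unfolding genus_def N_count_def
  using assms gaps_subset_nonzero_below finite_below by (metis DiffD1 card_mono has_Fb_def)

lemma card_B_set_le:
  assumes S: "c_semigroup C S" and f: "has_Fb S f"
  shows "card (B_set C f) \<le> 2 * genus C S"
proof -
  let ?B = "B_set C f"
  have fin: "finite ?B" "finite (C - S)"
    using S f finite_B_set unfolding c_semigroup_def has_Fb_def by auto
  have "(\<lambda>x. f - x) ` (?B \<inter> S) \<subseteq> C - S"
  proof (rule image_subsetI)
    fix x assume x: "x \<in> ?B \<inter> S"
    \<comment> \<open>Otherwise closure under addition would put \<open>f = x + (f - x)\<close> into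
      \<open>S\<close>.\<close>
    then have "f - x \<notin> S"
      using B_set_diff(2)[of x C f] S f unfolding c_semigroup_def has_Fb_def by force
    then show "f - x \<in> C - S"
      using x by (simp add: B_set_def)
  qed
  then have "card (?B \<inter> S) \<le> card (C - S)"
    by (intro card_inj_on_le[OF inj_on_subset[OF inj_on_diff_B_set]] fin) auto
  moreover have "card (?B - S) \<le> card (C - S)"
    by (rule card_mono[OF fin(2)]) (auto simp: B_set_def)
  ultimately show ?thesis
    using card_Int_Diff[OF fin(1), of S] unfolding genus_def by linarith
qed

section \<open>Semigroups with a prescribed Frobenius element\<close>

lemma remove_least:
  assumes S: "c_semigroup C S" and f: "has_Fb S f" and less: "genus C S < N_count r C f"
  obtains T where "c_semigroup C T" "has_Fb T f" "genus C T = Suc (genus C S)"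
proof -
  let ?X = "nonzero_below r C f \<inter> S"
  have fin: "finite (nonzero_below r C f)"
    using f finite_below unfolding has_Fb_def by simp
  have "?X \<noteq> {}"
  proof
    assume "?X = {}"
    then have "nonzero_below r C f \<subseteq> C - S"
      by (auto simp: nonzero_below_def)
    then have "N_count r C f \<le> genus C S"
      using S unfolding c_semigroup_def N_count_def genus_def by (simp add: card_mono)
    then show False
      using less by simp
  qed
  then obtain m where m: "m \<in> ?X" and least: "\<And>x. x \<in> ?X \<Longrightarrow> m \<preceq> x"
    using finite_has_least[of ?X] fin by auto
  have mC: "m \<in> C" "m \<noteq> 0" "m \<preceq> f" "m \<in> S"
    using m by (auto simp: nonzero_below_def)
  have gaps: "C - (S - {m}) = insert m (C - S)"
    using mC by auto
  \<comment> \<open>Closure survives because \<open>m\<close> is indecomposable: a nonzero summand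
    of \<open>m\<close> in \<open>S\<close> lies below \<open>m\<close>, hence equals
    \<open>m\<close> by minimality.\<close>
  have "x + y \<noteq> m" if "x \<in> S - {m}" "y \<in> S - {m}" for x y
  proof
    assume xy: "x + y = m"
    then have "x \<preceq> m"
      using le_add by blast
    moreover have "x \<noteq> 0"
      using xy that by auto
    ultimately have "x \<in> ?X"
      using that S mC(3) le_trans unfolding c_semigroup_def nonzero_below_def by blast
    then have "x = m"
      using least \<open>x \<preceq> m\<close> le_antisym by blast
    then show False
      using that by simp
  qed
  then have "c_semigroup C (S - {m})"
    using S mC unfolding c_semigroup_def gaps by auto
  moreover have "has_Fb (S - {m}) f"
    using f mC unfolding has_Fb_def gaps by auto
  moreover have "genus C (S - {m}) = Suc (genus C S)"
    using S mC(4) unfolding genus_def gaps c_semigroup_def by simp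
  ultimately show ?thesis
    using that by blast
qed

lemma exists_genus:
  assumes "c_semigroup C S" "has_Fb S f" "genus C S \<le> g" "g \<le> N_count r C f"
  shows "\<exists>T. c_semigroup C T \<and> has_Fb T f \<and> genus C T = g"
  using assms(3,4)
proof (induction g rule: dec_induct)
  case base
  then show ?case using assms by blast
next
  case (step n)
  then obtain T where "c_semigroup C T" "has_Fb T f" "genus C T = n"
    by auto
  then show ?case
    using remove_least step.prems by (metis Suc_le_eq)
qed

text \<open>The extra 1 allows for an element with \<open>x + x = f\<close>, which the reflection
  pairs with itself.\<close>

lemma exists_small_genus:
  assumes f: "f \<in> C" "f \<noteq> 0"
  shows "\<exists>S. c_semigroup C S \<and> has_Fb S f \<and> 2 * genus C S \<le> card (B_set C f) + 1"
proof -
  let ?B = "B_set C f"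
  \<comment> \<open>For \<open>x\<close> in \<open>B_set C f\<close>,
    \<open>x + x \<preceq> f\<close> says that \<open>x\<close> is the smaller element of its pair.
    The pair of \<open>0\<close> and \<open>f\<close> is the exception: \<open>0\<close> must stay
    in \<open>S\<close>, so \<open>f\<close> is the gap, although its double is not below
    \<open>f\<close>.\<close>
  define G where "G = {x \<in> ?B. x \<noteq> 0 \<and> (x + x \<preceq> f \<or> x = f)}"
  define S where "S = C - G"
  have zero: "0 \<in> C"
    by (rule zero_in_cone[OF cone])
  have "G \<subseteq> C"
    by (auto simp: G_def B_set_def)
  then have gaps: "C - S = G"
    unfolding S_def by auto
  have finB: "finite ?B"
    using finite_B_set f by simp
  then have finG: "finite G"
    by (simp add: G_def)
  have fG: "f \<in> G"
    using f zero unfolding G_def B_set_iff by force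
  have add: "x + y \<in> S" if "x \<in> S" "y \<in> S" for x y
  proof (rule ccontr)
    have C: "x \<in> C" "y \<in> C" "x \<notin> G" "y \<notin> G"
      using that by (auto simp: S_def)
    assume "x + y \<notin> S"
    then have xy: "x + y \<in> G"
      using cone_add[OF cone C(1,2)] by (simp add: S_def)
    \<comment> \<open>The complement \<open>z\<close> of \<open>x + y\<close> shows that both
      summands lie in \<open>B_set C f\<close>, with complements \<open>y + z\<close> and
      \<open>x + z\<close>.\<close>
    then obtain z where z: "z \<in> C" "x + y + z = f"
      unfolding G_def B_set_iff by blast
    then have "x + (y + z) = f" "y + (x + z) = f"
      by (simp_all add: ac_simps)
    then have "x \<in> ?B" "y \<in> ?B"
      using C z(1) cone_add[OF cone] unfolding B_set_iff by blast+
    moreover have "x + y \<preceq> f"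
      using z(2) le_add by blast
    \<comment> \<open>If both were nonzero, the one whose double is below \<open>f\<close> would
      belong to \<open>G\<close>.\<close>
    ultimately have "x = 0 \<or> y = 0"
      using add_le_imp C(3,4) unfolding G_def by blast
    then show False
      using xy C(3,4) by auto
  qed
  have "c_semigroup C S"
    unfolding c_semigroup_def gaps using zero finG add by (auto simp: S_def G_def)
  moreover have "has_Fb S f"
    unfolding has_Fb_def gaps using fG B_set_le by (auto simp: G_def)
  moreover have "2 * card G \<le> card ?B + 1"
  proof -
    let ?H = "(\<lambda>x. f - x) ` G"
    have inj: "inj_on (\<lambda>x. f - x) G"
      by (rule inj_on_subset[OF inj_on_diff_B_set[of f C]]) (auto simp: G_def)
    \<comment> \<open>If both members of a pair lie in \<open>G\<close>, each is below the other, so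
      they coincide.\<close>
    have half: "x + x = f" if xG: "x \<in> G" and xH: "x \<in> ?H" for x
    proof -
      obtain y where y: "y \<in> G" "x = f - y"
        using xH by blast
      then have sum: "y + x = f"
        using B_set_diff(2)[of y C f] by (simp add: G_def)
      have "x \<noteq> 0" "y \<noteq> 0"
        using xG y(1) by (auto simp: G_def)
      then have "x \<noteq> f" "y \<noteq> f"
        using sum by auto
      then have "x + x \<preceq> x + y" "y + y \<preceq> y + x"
        using xG y(1) sum by (auto simp: G_def add.commute)
      then have "x = y"
        using double_le_add le_antisym by blast
      then show ?thesis
        using sum by simp
    qed
    \<comment> \<open>Halves are unique coordinatewise, so \<open>G\<close> meets its reflection in
      at most one point.\<close>
    have "x = y" if "x + x = f" "y + y = f" for x y
    proof -
      have "x $ i + x $ i = y $ i + y $ i" for i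
        using that by (metis vector_add_component)
      then have "x $ i = y $ i" for i
        by (metis add_self_div_2)
      then show ?thesis
        by (simp add: vec_eq_iff)
    qed
    then have "\<forall>x\<in>G \<inter> ?H. \<forall>y\<in>G \<inter> ?H. x = y"
      using half by blast
    then have "card (G \<inter> ?H) \<le> 1"
      using finG by (simp add: card_le_Suc0_iff_eq)
    moreover have "card (G \<union> ?H) \<le> card ?B"
      using B_set_diff(1) by (intro card_mono finB) (auto simp: G_def)
    moreover have "card G + card ?H = card (G \<union> ?H) + card (G \<inter> ?H)"
      using finG by (intro card_Un_Int) auto
    ultimately show ?thesis
      using card_image[OF inj] by linarith
  qed
  ultimately show ?thesis
    unfolding genus_def gaps[symmetric] by blast
qed

end

theorem proposition10:
  fixes C :: "(nat ^ 'p) set" and r :: "(nat ^ 'p) rel" and g :: nat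
  assumes "affine_integer_cone C"
    and "compatible_total_order r"
    and "\<And>x. x \<in> C \<Longrightarrow> finite (nonzero_below r C x)"
    and "g > 0"
  shows "frobenius_elements r C g =
    {f \<in> C. \<lceil>real (card (B_set C f)) / 2\<rceil> \<le> int g \<and> g \<le> N_count r C f}"
proof -
  interpret ordered_cone C r
    by unfold_locales (use assms in auto)
  have ceil: "\<lceil>real (card (B_set C f)) / 2\<rceil> \<le> int g \<longleftrightarrow> card (B_set C f) \<le> 2 * g" for f
    by (simp add: ceiling_le_iff) linarith
  have "f \<in> frobenius_elements r C g \<longleftrightarrow>
      f \<in> C \<and> card (B_set C f) \<le> 2 * g \<and> g \<le> N_count r C f" for f
  proof
    assume "f \<in> frobenius_elements r C g"
    then obtain S where S: "f = Fb r C S" "c_semigroup C S" "genus C S = g"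
      unfolding frobenius_elements_def by blast
    then have "has_Fb S f"
      using has_Fb_Fb assms(4) by simp
    then show "f \<in> C \<and> card (B_set C f) \<le> 2 * g \<and> g \<le> N_count r C f"
      using S card_B_set_le genus_le_N_count unfolding has_Fb_def by blast
  next
    assume f: "f \<in> C \<and> card (B_set C f) \<le> 2 * g \<and> g \<le> N_count r C f"
    \<comment> \<open>Excludes \<open>f = 0\<close>, for which \<open>N_count r C f\<close> would be
      0, contrary to \<open>0 < g\<close>.\<close>
    have "nonzero_below r C 0 = {}"
      using zero_le le_antisym by (auto simp: nonzero_below_def)
    then have "f \<noteq> 0"
      using f assms(4) by (auto simp: N_count_def)
    then obtain S where S: "c_semigroup C S" "has_Fb S f"
        "2 * genus C S \<le> card (B_set C f) + 1"
      using exists_small_genus f by blast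
    \<comment> \<open>The bounds give \<open>2 * genus C S \<le> 2 * g + 1\<close>, and parity
      absorbs the extra 1.\<close>
    then have "genus C S \<le> g"
      using f by linarith
    then obtain T where "c_semigroup C T" "has_Fb T f" "genus C T = g"
      using exists_genus S f by blast
    then show "f \<in> frobenius_elements r C g"
      using Fb_eqI unfolding frobenius_elements_def by blast
  qed
  then show ?thesis
    unfolding ceil by blast
qed

end
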